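(* Fix some $0<\epsilon<1$ and consider the online setting on $k\ge 2$ vertices with costs $\ell_{ij}=1+\epsilon$ for all $i\neq j$. No online algorithm (randomized algorithms included) has a competitive ratio better (greater) than $\frac{(1+\epsilon)^2}{\epsilon}\cdot\frac1k$ for this metric.
   Context: $V$ is a set of $k$ vertices with distances $\ell_{ij}$. Time steps are $1,\dots,T$. A demand sequence is $d=(d^1,\dots,d^T)$ and a supply sequence is $s=(s^1,\dots,s^T)$, where each $d^t,s^t$ is a nonnegative vector indexed by $V$ with entries summing to $1$. The demand served at time $t$ is $\mathrm{ds}(s^t,d^t)=\sum_i\min(s^t_i,d^t_i)$. The earthmover distance $\mathrm{em}(s,s')$ is the minimum of $\sum_{u,v}f(u,v)\ell_{uv}$ over all $f\ge 0$ with $\sum_v f(u,v)=s_u$, $\sum_u f(u,v)=s'_v$ (with $\ell_{ii}=0$). The social welfare is $\mathrm{sw}(s,d)=\sum_{t=1}^T\mathrm{ds}(s^t,d^t)-\sum_{t=2}^T\mathrm{em}(s^{t-1},s^t)$. An online algorithm $\mathrm{Alg}$ chooses $s^t$ as a (possibly randomized) function of $d^1,\dots,d^t$. Its competitive ratio is the worst case (infimum), over demand sequences $d$ (of any length $T$), of $\mathrm{sw}(\mathrm{Alg}(d),d)/\max_s\mathrm{sw}(s,d)$, with the numerator replaced by its expectation for randomized algorithms. *)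

theory Defs
  imports "HOL-Probability.Probability"
begin

text \<open>The vertex set is the finite type \<open>'v\<close>; distances are a function \<open>'v \<Rightarrow> 'v \<Rightarrow> real\<close>.
  A sequence over the time steps \<open>1, \<dots>, T\<close> is a list of length \<open>T\<close>, so that step \<open>t\<close> is
  list position \<open>t - 1\<close>.\<close>

definition distributions :: "(real ^ 'v::finite) set" where
  "distributions = {x. (\<forall>i. 0 \<le> x $ i) \<and> (\<Sum>i\<in>UNIV. x $ i) = 1}"

definition sequences :: "nat \<Rightarrow> (real ^ 'v::finite) list set" where
  "sequences T = {xs. length xs = T \<and> set xs \<subseteq> distributions}"

definition demand_served :: "real ^ 'v::finite \<Rightarrow> real ^ 'v \<Rightarrow> real" where
  "demand_served s d = (\<Sum>i\<in>UNIV. min (s $ i) (d $ i))"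

definition flows :: "real ^ 'v::finite \<Rightarrow> real ^ 'v \<Rightarrow> ('v \<Rightarrow> 'v \<Rightarrow> real) set" where
  "flows s s' = {f. (\<forall>u v. 0 \<le> f u v) \<and>
                    (\<forall>u. (\<Sum>v\<in>UNIV. f u v) = s $ u) \<and>
                    (\<forall>v. (\<Sum>u\<in>UNIV. f u v) = s' $ v)}"

text \<open>For distributions the infimum here and the supremum in \<open>opt_welfare\<close> are attained, by
  compactness, so they are the minimum and the maximum.\<close>

definition earthmover :: "('v::finite \<Rightarrow> 'v \<Rightarrow> real) \<Rightarrow> real ^ 'v \<Rightarrow> real ^ 'v \<Rightarrow> real" where
  "earthmover l s s' = (INF f\<in>flows s s'. \<Sum>u\<in>UNIV. \<Sum>v\<in>UNIV. f u v * l u v)"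

definition social_welfare ::
    "('v::finite \<Rightarrow> 'v \<Rightarrow> real) \<Rightarrow> (real ^ 'v) list \<Rightarrow> (real ^ 'v) list \<Rightarrow> real" where
  "social_welfare l s d =
     (\<Sum>t<length d. demand_served (s ! t) (d ! t))
     - (\<Sum>t=1..<length d. earthmover l (s ! (t - 1)) (s ! t))"

definition opt_welfare :: "('v::finite \<Rightarrow> 'v \<Rightarrow> real) \<Rightarrow> (real ^ 'v) list \<Rightarrow> real" where
  "opt_welfare l d = (SUP s\<in>sequences (length d). social_welfare l s d)"

text \<open>\<open>A \<omega> [d\<^sup>1, \<dots>, d\<^sup>t]\<close> is the supply chosen at step \<open>t\<close> when the random outcome is \<open>\<omega>\<close>. One
  outcome governs all steps, so choices at different steps may be correlated arbitrarily.
  A deterministic algorithm is one that ignores \<open>\<omega>\<close>.\<close>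

definition online_algorithm ::
    "'w measure \<Rightarrow> ('w \<Rightarrow> (real ^ 'v::finite) list \<Rightarrow> real ^ 'v) \<Rightarrow> bool" where
  "online_algorithm M A \<longleftrightarrow> prob_space M \<and>
     (\<forall>t\<ge>1. \<forall>h\<in>sequences t.
        (\<lambda>\<omega>. A \<omega> h) \<in> borel_measurable M \<and> (\<forall>\<omega>\<in>space M. A \<omega> h \<in> distributions))"

definition run :: "((real ^ 'v::finite) list \<Rightarrow> real ^ 'v) \<Rightarrow> (real ^ 'v) list \<Rightarrow> (real ^ 'v) list"
  where "run a d = map (\<lambda>t. a (take t d)) [1..<Suc (length d)]"

text \<open>The empty sequence is excluded, since its ratio is \<open>0 / 0\<close>. For \<open>T \<ge> 1\<close> and nonnegative
  distances vanishing on the diagonal, the optimum is at least \<open>1\<close> (keep the supply at the first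
  demand), so the quotient is meaningful.\<close>

definition competitive_ratio ::
    "('v::finite \<Rightarrow> 'v \<Rightarrow> real) \<Rightarrow> 'w measure \<Rightarrow> ('w \<Rightarrow> (real ^ 'v) list \<Rightarrow> real ^ 'v) \<Rightarrow> ereal"
  where
  "competitive_ratio l M A =
     (INF d\<in>(\<Union>T\<in>{1..}. sequences T).
        ereal ((\<integral>\<omega>. social_welfare l (run (A \<omega>) d) d \<partial>M) / opt_welfare l d))"

end

theory Submission
  imports Defs
begin

text \<open>Let the demand sit on a single vertex, and let it be redrawn uniformly with probability
  \<open>1 / (1 + \<epsilon>)\<close> at every step. A visit then lasts \<open>1 + \<epsilon>\<close> steps on average, so moving supply
  never pays for an online algorithm, which earns about \<open>1 / k\<close> per step. Looking one step ahead,
  the offline player moves only to visits of length at least \<open>2\<close> and earns at least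
  \<open>\<epsilon> / (1 + \<epsilon>)\<^sup>2\<close> per step. Both estimates are potential arguments with a
  one-step average, so the random demand is derandomized by the method of conditional
  expectations: at every step some demand vertex does at least as well as the average.\<close>

section \<open>Distributions and the demand they serve\<close>

lemma distributions_nonneg: "s \<in> distributions \<Longrightarrow> 0 \<le> s $ i"
  by (simp add: distributions_def)

lemma distributions_le_1:
  assumes "s \<in> distributions" shows "s $ i \<le> 1"
proof -
  have "s $ i \<le> (\<Sum>j\<in>UNIV. s $ j)"
    by (rule member_le_sum) (use assms in \<open>auto simp: distributions_def\<close>)
  then show ?thesis using assms by (simp add: distributions_def)
qed

lemma axis_in_distributions: "axis v (1::real) \<in> distributions"
  by (simp add: distributions_def axis_def)

lemma snoc_in_sequences:
  "xs \<in> sequences n \<Longrightarrow> x \<in> distributions \<Longrightarrow> xs @ [x] \<in> sequences (Suc n)"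
  by (simp add: sequences_def)

lemma demand_served_axis:
  assumes "s \<in> distributions" shows "demand_served s (axis v 1) = s $ v"
proof -
  have "min (s $ i) (axis v 1 $ i) = (if i = v then s $ i else 0)" for i
    using distributions_nonneg[OF assms, of i] distributions_le_1[OF assms, of i]
    by (auto simp: axis_def)
  then show ?thesis by (simp add: demand_served_def)
qed

lemma demand_served_le_1: "s \<in> distributions \<Longrightarrow> demand_served s d \<le> 1"
  unfolding demand_served_def distributions_def
  by (metis (mono_tags, lifting) mem_Collect_eq min.cobounded1 sum_mono)

section \<open>Bounds on the earthmover distance\<close>

lemma flows_nonempty:
  assumes "s \<in> distributions" "s' \<in> distributions" shows "flows s s' \<noteq> {}"
proof -
  have "(\<lambda>u v. s $ u * s' $ v) \<in> flows s s'"
    using assms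
    by (simp add: flows_def distributions_def flip: sum_distrib_left sum_distrib_right)
  then show ?thesis by blast
qed

text \<open>At most \<open>s $ v\<close> of the mass ending at \<open>v\<close> can have stayed
  there; the rest comes from other vertices at unit cost at least \<open>c\<close>. The bound also
  holds, trivially, when supply at \<open>v\<close> drops, and \<open>c = 0\<close> gives
  nonnegativity.\<close>

lemma earthmover_ge:
  assumes s: "s \<in> distributions" "s' \<in> distributions"
    and "0 \<le> c" and l: "\<And>u v. 0 \<le> l u v" "\<And>u v. u \<noteq> v \<Longrightarrow> c \<le> l u v"
  shows "c * (s' $ v - s $ v) \<le> earthmover l s s'"
  unfolding earthmover_def
proof (rule cINF_greatest)
  show "flows s s' \<noteq> {}" using s by (rule flows_nonempty)
next
  fix f assume "f \<in> flows s s'"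
  then have f: "\<And>u w. 0 \<le> f u w" "\<And>u. (\<Sum>w\<in>UNIV. f u w) = s $ u"
    "(\<Sum>u\<in>UNIV. f u v) = s' $ v"
    by (auto simp: flows_def)
  have "f v v \<le> (\<Sum>w\<in>UNIV. f v w)"
    by (rule member_le_sum) (use f in auto)
  then have fv: "f v v \<le> s $ v" by (simp add: f)
  have "s' $ v - f v v = (\<Sum>u\<in>UNIV - {v}. f u v)"
    using f(3) sum.remove[of UNIV v "\<lambda>u. f u v"] by simp
  then have "c * (s' $ v - s $ v) \<le> c * (\<Sum>u\<in>UNIV - {v}. f u v)"
    using fv \<open>0 \<le> c\<close> by (intro mult_left_mono) auto
  also have "\<dots> = (\<Sum>u\<in>UNIV - {v}. f u v * c)"
    by (simp add: sum_distrib_left mult.commute)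
  also have "\<dots> \<le> (\<Sum>u\<in>UNIV - {v}. f u v * l u v)"
    by (intro sum_mono mult_left_mono) (use f l in auto)
  also have "\<dots> \<le> (\<Sum>u\<in>UNIV. f u v * l u v)"
    by (rule sum_mono2) (use f l in auto)
  also have "\<dots> \<le> (\<Sum>u\<in>UNIV. \<Sum>w\<in>UNIV. f u w * l u w)"
    by (intro sum_mono member_le_sum) (use f l in auto)
  finally show "c * (s' $ v - s $ v) \<le> (\<Sum>u\<in>UNIV. \<Sum>w\<in>UNIV. f u w * l u w)" .
qed

lemma earthmover_nonneg:
  assumes "s \<in> distributions" "s' \<in> distributions" and "\<And>u v. 0 \<le> l u v"
  shows "0 \<le> earthmover l s s'"
  using earthmover_ge[of s s' 0 l] assms by simp

lemma earthmover_axis_le: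
  assumes l: "\<And>u v. 0 \<le> l u v"
  shows "earthmover l (axis a 1) (axis b 1) \<le> l a b"
proof -
  define f :: "'a \<Rightarrow> 'a \<Rightarrow> real" where "f u v = (if v = b then if u = a then 1 else 0 else 0)" for u v
  have f: "f \<in> flows (axis a 1) (axis b 1)"
    by (auto simp: flows_def f_def axis_def)
  \<comment> \<open>The infimum is over reals, so boundedness is needed before the explicit flow can
    bound it from above.\<close>
  have "bdd_below ((\<lambda>f. \<Sum>u\<in>UNIV. \<Sum>v\<in>UNIV. f u v * l u v) ` flows (axis a 1) (axis b 1))"
    by (rule bdd_belowI2[of _ 0]) (auto simp: flows_def l intro!: sum_nonneg)
  from cINF_lower[OF this f]
  have "earthmover l (axis a 1) (axis b 1) \<le> (\<Sum>u\<in>UNIV. \<Sum>v\<in>UNIV. f u v * l u v)"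
    by (simp add: earthmover_def)
  also have "\<dots> = (\<Sum>u\<in>UNIV. \<Sum>v\<in>UNIV. if v = b then (if u = a then l u v else 0) else 0)"
    by (intro sum.cong) (auto simp: f_def)
  also have "\<dots> = l a b"
    by simp
  finally show ?thesis .
qed

section \<open>Welfare and runs when one step is appended\<close>

lemma social_welfare_singleton: "social_welfare l [s] [d] = demand_served s d"
  by (simp add: social_welfare_def)

text \<open>Isolates the contribution of the newest step. The first step has no preceding supply and
  hence no moving cost, which is why \<open>d\<close> must be nonempty.\<close>

lemma social_welfare_snoc:
  assumes "length s = length d" "d \<noteq> []"
  shows "social_welfare l (s @ [s']) (d @ [d']) =
    social_welfare l s d + demand_served s' d' - earthmover l (last s) s'"
proof -
  obtain n where n: "length d = Suc n" using assms by (cases d) auto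
  have *: "(\<Sum>t<Suc n. demand_served ((s @ [s']) ! t) ((d @ [d']) ! t)) =
      (\<Sum>t<Suc n. demand_served (s ! t) (d ! t))"
    by (rule sum.cong) (use n assms in \<open>auto simp: nth_append\<close>)
  have **: "(\<Sum>t=1..<Suc n. earthmover l ((s @ [s']) ! (t - 1)) ((s @ [s']) ! t)) =
      (\<Sum>t=1..<Suc n. earthmover l (s ! (t - 1)) (s ! t))"
    by (rule sum.cong) (use n assms in \<open>auto simp: nth_append\<close>)
  have "last s = s ! n" using assms n by (subst last_conv_nth) auto
  then have last: "earthmover l ((s @ [s']) ! n) ((s @ [s']) ! Suc n) = earthmover l (last s) s'"
    using n assms by (simp add: nth_append)
  have len: "length (d @ [d']) = Suc (Suc n)" using n by simp
  have "social_welfare l (s @ [s']) (d @ [d']) =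
    (\<Sum>t<Suc n. demand_served ((s @ [s']) ! t) ((d @ [d']) ! t)) + demand_served s' d'
    - ((\<Sum>t=1..<Suc n. earthmover l ((s @ [s']) ! (t - 1)) ((s @ [s']) ! t))
       + earthmover l (last s) s')"
    unfolding social_welfare_def len
    using last n assms by (simp add: nth_append)
  then show ?thesis unfolding * ** by (simp add: social_welfare_def n)
qed

lemma social_welfare_le_opt_welfare:
  assumes "s \<in> sequences (length d)" and l: "\<And>u v. 0 \<le> l u v"
  shows "social_welfare l s d \<le> opt_welfare l d"
  unfolding opt_welfare_def
proof (rule cSUP_upper[OF assms(1)], rule bdd_aboveI2)
  fix s' :: "(real ^ 'a) list" assume s': "s' \<in> sequences (length d)"
  then have mem: "s' ! t \<in> distributions" if "t < length d" for t
    using that by (auto simp: sequences_def)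
  have "(\<Sum>t<length d. demand_served (s' ! t) (d ! t)) \<le> (\<Sum>t<length d. 1)"
    by (intro sum_mono demand_served_le_1 mem) auto
  moreover have "0 \<le> (\<Sum>t=1..<length d. earthmover l (s' ! (t - 1)) (s' ! t))"
    by (intro sum_nonneg earthmover_nonneg mem l) auto
  ultimately show "social_welfare l s' d \<le> real (length d)"
    by (simp add: social_welfare_def)
qed

lemma length_run [simp]: "length (run a d) = length d"
  by (simp add: run_def del: upt_Suc)

lemma run_snoc: "run a (d @ [x]) = run a d @ [a (d @ [x])]"
  by (auto simp: run_def)

lemma last_run: "d \<noteq> [] \<Longrightarrow> last (run a d) = a d"
  by (cases d rule: rev_cases) (simp_all add: run_snoc)

text \<open>The left side is the mean of \<open>\<theta>\<close> when the demand stays at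
  \<open>x\<close> with probability \<open>1 - q\<close> and is otherwise redrawn uniformly. A
  maximizer of \<open>\<theta>\<close> beats this mean, which is what removes the randomness from
  the demand.\<close>

lemma obtain_ge_average:
  fixes \<theta> :: "'v::finite \<Rightarrow> real"
  assumes "0 \<le> q" "q \<le> 1"
  obtains v where "(1 - q) * \<theta> x + q / real CARD('v) * (\<Sum>w\<in>UNIV. \<theta> w) \<le> \<theta> v"
proof -
  obtain v where v: "\<And>w. \<theta> w \<le> \<theta> v"
  proof -
    have "Max (range \<theta>) \<in> range \<theta>" by (rule Max_in) auto
    then obtain v where "Max (range \<theta>) = \<theta> v" by blast
    then have "\<theta> w \<le> \<theta> v" for w using Max_ge[of "range \<theta>" "\<theta> w"] by simp
    then show ?thesis using that by blast
  qed
  have "(\<Sum>w\<in>UNIV. \<theta> w) \<le> real CARD('v) * \<theta> v"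
    using sum_bounded_above[of UNIV \<theta> "\<theta> v"] v by simp
  then have "q / real CARD('v) * (\<Sum>w\<in>UNIV. \<theta> w) \<le> q / real CARD('v) * (real CARD('v) * \<theta> v)"
    using assms by (intro mult_left_mono) auto
  moreover have "(1 - q) * \<theta> x \<le> (1 - q) * \<theta> v"
    using assms v by (intro mult_left_mono) auto
  ultimately have "(1 - q) * \<theta> x + q / real CARD('v) * (\<Sum>w\<in>UNIV. \<theta> w) \<le> \<theta> v"
    by (simp add: algebra_simps)
  then show ?thesis using that by blast
qed

section \<open>Offline welfare certificates\<close>

text \<open>Certifies offline welfare \<open>G\<close>, and welfare \<open>H\<close> when the supply has to end at the current
  demand vertex \<open>x\<close>. Keeping both is what allows a supply to move in anticipation of a
  repeated demand.\<close>

definition offline_state ::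
    "('v::finite \<Rightarrow> 'v \<Rightarrow> real) \<Rightarrow> (real ^ 'v) list \<Rightarrow> 'v \<Rightarrow> real \<Rightarrow> real \<Rightarrow> bool" where
  "offline_state l d x G H \<longleftrightarrow> d \<noteq> [] \<and> d \<in> sequences (length d) \<and> 1 \<le> G \<and> 0 \<le> H \<and> H \<le> G \<and>
    (\<exists>s z. s \<in> sequences (length d) \<and> last s = axis z 1 \<and> G \<le> social_welfare l s d) \<and>
    (\<exists>s. s \<in> sequences (length d) \<and> last s = axis x 1 \<and> H \<le> social_welfare l s d)"

lemma offline_state_singleton: "offline_state l [axis x 1] x 1 1"
proof -
  have "[axis x (1::real)] \<in> sequences (Suc 0)"
    by (simp add: sequences_def axis_in_distributions)
  moreover have "social_welfare l [axis x 1] [axis x 1] = 1"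
    by (simp add: social_welfare_singleton demand_served_axis axis_in_distributions)
  ultimately show ?thesis
    unfolding offline_state_def
    by (intro conjI exI[of _ "[axis x (1::real)]"] exI[of _ x]) auto
qed

lemma offline_state_imp_opt_welfare_ge:
  assumes "offline_state l d x G H" "\<And>u v. 0 \<le> l u v"
  shows "G \<le> opt_welfare l d"
  using assms social_welfare_le_opt_welfare[of _ d l]
  unfolding offline_state_def by (meson order_trans)

lemma supply_snoc:
  assumes s: "s \<in> sequences (length d)" "last s = axis z 1" "W \<le> social_welfare l s d"
    and "d \<noteq> []" and l: "\<And>u v. 0 \<le> l u v"
  shows "s @ [axis y 1] \<in> sequences (length (d @ [axis v 1])) \<and> last (s @ [axis y 1]) = axis y 1 \<and>
    W + (if y = v then 1 else 0) - l z y \<le> social_welfare l (s @ [axis y 1]) (d @ [axis v 1])"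
proof -
  have "length s = length d" using s by (simp add: sequences_def)
  then have "social_welfare l (s @ [axis y 1]) (d @ [axis v 1]) =
      social_welfare l s d + (if y = v then 1 else 0) - earthmover l (axis z 1) (axis y 1)"
    using assms by (simp add: social_welfare_snoc demand_served_axis axis_in_distributions)
      (simp add: axis_def)
  then show ?thesis
    using s earthmover_axis_le[of l z y, OF l]
    by (auto simp: snoc_in_sequences axis_in_distributions)
qed

text \<open>On a repeated demand, the supply already at \<open>x\<close> stays and earns
  \<open>1\<close>. On a new demand, the supply behind \<open>G\<close> stays at its vertex
  \<open>z\<close>; for \<open>H\<close> it moves from \<open>z\<close> to \<open>v\<close>, paying
  at most \<open>1 + \<epsilon>\<close> and earning \<open>1\<close>. Since \<open>1 \<le> G\<close>
  and \<open>\<epsilon> \<le> 1\<close>, the new \<open>H\<close> stays nonnegative.\<close>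

lemma offline_state_snoc:
  assumes st: "offline_state l d x G H" and "0 \<le> \<epsilon>" "\<epsilon> \<le> 1"
    and l: "\<And>u v. 0 \<le> l u v" "\<And>u. l u u = 0" "\<And>u v. l u v \<le> 1 + \<epsilon>"
  shows "offline_state l (d @ [axis v 1]) v
    (if v = x then H + 1 else G) (if v = x then H + 1 else G - \<epsilon>)"
proof -
  have d: "d \<noteq> []" "d \<in> sequences (length d)" and GH: "1 \<le> G" "0 \<le> H" "H \<le> G"
    using st by (auto simp: offline_state_def)
  obtain s z where s: "s \<in> sequences (length d)" "last s = axis z 1" "G \<le> social_welfare l s d"
    using st by (auto simp: offline_state_def)
  obtain s' where s': "s' \<in> sequences (length d)" "last s' = axis x 1" "H \<le> social_welfare l s' d"
    using st by (auto simp: offline_state_def)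
  have d': "d @ [axis v 1] \<in> sequences (length (d @ [axis v 1]))"
    using d by (simp add: snoc_in_sequences axis_in_distributions)
  show ?thesis
  proof (cases "v = x")
    case True
    have "s' @ [axis v 1] \<in> sequences (length (d @ [axis v 1])) \<and> last (s' @ [axis v 1]) = axis v 1 \<and>
        H + 1 \<le> social_welfare l (s' @ [axis v 1]) (d @ [axis v 1])"
      using supply_snoc[OF s' d(1) l(1), of v v] l(2)[of v] True by simp
    then show ?thesis
      using d' GH True unfolding offline_state_def by fastforce
  next
    case False
    have "s @ [axis z 1] \<in> sequences (length (d @ [axis v 1])) \<and> last (s @ [axis z 1]) = axis z 1 \<and>
        G \<le> social_welfare l (s @ [axis z 1]) (d @ [axis v 1])"
      using supply_snoc[OF s d(1) l(1), of z v] l(2)[of z] by (auto split: if_splits)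
    moreover have "s @ [axis v 1] \<in> sequences (length (d @ [axis v 1])) \<and>
        last (s @ [axis v 1]) = axis v 1 \<and>
        G - \<epsilon> \<le> social_welfare l (s @ [axis v 1]) (d @ [axis v 1])"
      using supply_snoc[OF s d(1) l(1), of v v] l(3)[of z v] by simp
    ultimately show ?thesis
      using d' GH False assms(2,3) unfolding offline_state_def by fastforce
  qed
qed

section \<open>Expected supply and welfare of the online algorithm\<close>

lemma online_algorithm_nth:
  assumes "online_algorithm M A" "d \<noteq> []" "d \<in> sequences (length d)"
  shows "integrable M (\<lambda>\<omega>. A \<omega> d $ v)"
    and "0 \<le> (\<integral>\<omega>. A \<omega> d $ v \<partial>M)"
    and "(\<Sum>w\<in>UNIV. \<integral>\<omega>. A \<omega> d $ w \<partial>M) = 1"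
proof -
  interpret prob_space M using assms by (simp add: online_algorithm_def)
  have "length d \<ge> 1" using assms(2) by (cases d) auto
  with assms have A: "(\<lambda>\<omega>. A \<omega> d) \<in> borel_measurable M"
      "\<And>\<omega>. \<omega> \<in> space M \<Longrightarrow> A \<omega> d \<in> distributions"
    unfolding online_algorithm_def by blast+
  have int: "integrable M (\<lambda>\<omega>. A \<omega> d $ w)" for w
  proof (rule integrable_const_bound[where B = 1])
    show "(\<lambda>\<omega>. A \<omega> d $ w) \<in> borel_measurable M"
      using measurable_compose[OF A(1), of "\<lambda>x. x $ w" borel]
      by (simp add: borel_measurable_continuous_onI continuous_on_component)
    show "AE \<omega> in M. norm (A \<omega> d $ w) \<le> 1"
      using A(2) by (intro AE_I2) (simp add: distributions_nonneg distributions_le_1)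
  qed
  show "integrable M (\<lambda>\<omega>. A \<omega> d $ v)" by (rule int)
  show "0 \<le> (\<integral>\<omega>. A \<omega> d $ v \<partial>M)"
    using A(2) by (intro Bochner_Integration.integral_nonneg) (simp add: distributions_nonneg)
  have "(\<Sum>w\<in>UNIV. \<integral>\<omega>. A \<omega> d $ w \<partial>M) = (\<integral>\<omega>. (\<Sum>w\<in>UNIV. A \<omega> d $ w) \<partial>M)"
    using int by simp
  also have "\<dots> = (\<integral>\<omega>. 1 \<partial>M)"
    using A(2) by (intro Bochner_Integration.integral_cong) (auto simp: distributions_def)
  finally show "(\<Sum>w\<in>UNIV. \<integral>\<omega>. A \<omega> d $ w \<partial>M) = 1" by (simp add: prob_space)
qed

text \<open>For each outcome, let \<open>a\<close> and \<open>b\<close> be the supply at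
  \<open>v\<close> before and after the step. The step gains at most \<open>b - (1 + \<epsilon>) *
  (b - a) = (1 + \<epsilon>) * a - \<epsilon> * b\<close>. Charging \<open>\<epsilon> * b\<close> as
  a potential thus leaves a bound that no longer depends on the response to
  \<open>v\<close>.\<close>

lemma online_welfare_snoc_le:
  fixes l :: "'v::finite \<Rightarrow> 'v \<Rightarrow> real"
  assumes A: "online_algorithm M A" and d: "d \<noteq> []" "d \<in> sequences (length d)"
    and l: "\<And>u v. 0 \<le> l u v" "\<And>u v. u \<noteq> v \<Longrightarrow> 1 + \<epsilon> \<le> l u v" and "0 \<le> \<epsilon>"
    and int: "integrable M (\<lambda>\<omega>. social_welfare l (run (A \<omega>) d) d)"
      "integrable M (\<lambda>\<omega>. social_welfare l (run (A \<omega>) (d @ [axis v 1])) (d @ [axis v 1]))"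
  shows "(\<integral>\<omega>. social_welfare l (run (A \<omega>) (d @ [axis v 1])) (d @ [axis v 1]) \<partial>M)
      + \<epsilon> * (\<integral>\<omega>. A \<omega> (d @ [axis v 1]) $ v \<partial>M)
    \<le> (\<integral>\<omega>. social_welfare l (run (A \<omega>) d) d \<partial>M) + (1 + \<epsilon>) * (\<integral>\<omega>. A \<omega> d $ v \<partial>M)"
proof -
  let ?d = "d @ [axis v 1]"
  have d': "?d \<noteq> []" "?d \<in> sequences (length ?d)"
    using d by (simp_all add: snoc_in_sequences axis_in_distributions)
  note intA = online_algorithm_nth(1)[OF A d, of v] online_algorithm_nth(1)[OF A d', of v]
  have "(\<integral>\<omega>. social_welfare l (run (A \<omega>) ?d) ?d + \<epsilon> * (A \<omega> ?d $ v) \<partial>M)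
      \<le> (\<integral>\<omega>. social_welfare l (run (A \<omega>) d) d + (1 + \<epsilon>) * (A \<omega> d $ v) \<partial>M)"
  proof (rule integral_mono)
    fix \<omega> assume \<omega>: "\<omega> \<in> space M"
    have "length d \<ge> 1" using d by (cases d) auto
    then have "A \<omega> d \<in> distributions" "A \<omega> ?d \<in> distributions"
      using A \<omega> d d' unfolding online_algorithm_def by (blast, auto)
    then have "(1 + \<epsilon>) * (A \<omega> ?d $ v - A \<omega> d $ v) \<le> earthmover l (A \<omega> d) (A \<omega> ?d)"
      and "demand_served (A \<omega> ?d) (axis v 1) = A \<omega> ?d $ v"
      using l \<open>0 \<le> \<epsilon>\<close> by (auto intro!: earthmover_ge demand_served_axis)
    then show "social_welfare l (run (A \<omega>) ?d) ?d + \<epsilon> * (A \<omega> ?d $ v)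
        \<le> social_welfare l (run (A \<omega>) d) d + (1 + \<epsilon>) * (A \<omega> d $ v)"
      using d by (simp add: run_snoc social_welfare_snoc last_run algebra_simps)
  qed (use int intA in auto)
  then show ?thesis using int intA by simp
qed

section \<open>The potential argument\<close>

theorem theorem5p12:
  fixes \<epsilon> :: real and k :: nat
    and l :: "'v::finite \<Rightarrow> 'v \<Rightarrow> real"
    and M :: "'w measure"
    and A :: "'w \<Rightarrow> (real ^ 'v) list \<Rightarrow> real ^ 'v"
  assumes "0 < \<epsilon>" and "\<epsilon> < 1"
    and "CARD('v) = k" and "k \<ge> 2"
    and "\<And>i. l i i = 0"
    and "\<And>i j. i \<noteq> j \<Longrightarrow> l i j = 1 + \<epsilon>"
    and "online_algorithm M A"
  shows "competitive_ratio l M A \<le> ereal ((1 + \<epsilon>)\<^sup>2 / \<epsilon> * (1 / real k))"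
proof (rule ccontr)
  assume "\<not> ?thesis"
  \<comment> \<open>The strict gap between the bound and \<open>r\<close> becomes the positive drift
    \<open>\<eta>\<close>.\<close>
  then obtain r where r: "(1 + \<epsilon>)\<^sup>2 / \<epsilon> * (1 / real k) < r" "ereal r < competitive_ratio l M A"
    using ereal_dense2[of "ereal ((1 + \<epsilon>)\<^sup>2 / \<epsilon> * (1 / real k))"] by (auto simp: not_le)
  have "0 \<le> (1 + \<epsilon>)\<^sup>2 / \<epsilon> * (1 / real k)" using assms by simp
  with r(1) have "0 < r" by linarith
  have l: "\<And>u v. 0 \<le> l u v" "\<And>u v. l u v \<le> 1 + \<epsilon>" "\<And>u v. u \<noteq> v \<Longrightarrow> 1 + \<epsilon> \<le> l u v"
    using assms(1,5,6) by (metis add_nonneg_nonneg less_eq_real_def zero_le_one order_refl)+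
  define W where "W d = (\<integral>\<omega>. social_welfare l (run (A \<omega>) d) d \<partial>M)" for d
  define m where "m d v = (\<integral>\<omega>. A \<omega> d $ v \<partial>M)" for d v
  \<comment> \<open>The redraw probability. With \<open>p * (1 + \<epsilon>) = 1\<close> also
    \<open>(1 - p) * (1 + \<epsilon>) = \<epsilon>\<close>, so the potential term
    \<open>\<epsilon> * m d x\<close> reproduces itself under averaging.\<close>
  define p where "p = 1 / (1 + \<epsilon>)"
  \<comment> \<open>The probability that the next demand is again \<open>x\<close>: no redraw, or a
    redraw that hits \<open>x\<close>.\<close>
  define \<sigma> where "\<sigma> = 1 - p + p / real k"
  \<comment> \<open>The drift per step: \<open>r\<close> times the offline rate, minus the online
    rate \<open>1 / real k\<close>.\<close>
  define \<eta> where "\<eta> = r * (\<sigma> * (1 - \<epsilon> + \<epsilon> * \<sigma>)) - 1 / real k"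
  \<comment> \<open>\<open>H\<close> is the certificate continued on a repeat and \<open>G\<close>
    the one continued otherwise, hence the weights \<open>\<sigma>\<close> and
    \<open>1 - \<sigma>\<close>.\<close>
  define \<Phi> where "\<Phi> d x G H = r * ((1 - \<sigma>) * G + \<sigma> * H) - W d - \<epsilon> * m d x" for d x G H
  have k: "0 < real k" using assms(4) by simp
  have p: "0 < p" "p \<le> 1" "p * (1 + \<epsilon>) = 1" using assms(1) by (auto simp: p_def)
  have "p / real k \<le> p" using p assms(4) by (simp add: divide_le_eq)
  then have \<sigma>: "1 - p \<le> \<sigma>" "\<sigma> \<le> 1" using p k by (auto simp: \<sigma>_def)
  have W_ge: "r * G \<le> W d" if st: "offline_state l d x G H" for d x G H
  proof -
    have d: "d \<in> (\<Union>T\<in>{1..}. sequences T)"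
      using st by (auto simp: offline_state_def Suc_le_eq intro!: bexI[of _ "length d"])
    have "ereal r < ereal (W d / opt_welfare l d)"
      using r(2) INF_lower[OF d] unfolding competitive_ratio_def W_def
      by (rule less_le_trans)
    moreover have "G \<le> opt_welfare l d" "1 \<le> G"
      using st offline_state_imp_opt_welfare_ge[OF st l(1)] by (auto simp: offline_state_def)
    ultimately have "r * opt_welfare l d < W d" by (simp add: pos_less_divide_eq)
    moreover have "r * G \<le> r * opt_welfare l d"
      using \<open>0 < r\<close> \<open>G \<le> opt_welfare l d\<close> by simp
    ultimately show ?thesis by simp
  qed
  \<comment> \<open>The Bochner integral of a non-integrable function is \<open>0\<close>, so a positive expected welfare
    gives integrability without measurability of the earthmover distance.\<close>
  have int: "integrable M (\<lambda>\<omega>. social_welfare l (run (A \<omega>) d) d)"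
    if st: "offline_state l d x G H" for d x G H
  proof (rule ccontr)
    assume "\<not> ?thesis"
    then have "W d = 0" by (simp add: W_def not_integrable_integral_eq)
    moreover have "0 < r * G" using st \<open>0 < r\<close> by (auto simp: offline_state_def)
    ultimately show False using W_ge[OF st] by simp
  qed
  have step: "\<exists>v G' H'. offline_state l (d @ [axis v 1]) v G' H' \<and>
      \<Phi> d x G H + \<eta> \<le> \<Phi> (d @ [axis v 1]) v G' H'"
    if st: "offline_state l d x G H" for d x G H
  proof -
    define G' where "G' v = (if v = x then H + 1 else G)" for v
    define H' where "H' v = (if v = x then H + 1 else G - \<epsilon>)" for v
    have st': "offline_state l (d @ [axis v 1]) v (G' v) (H' v)" for v
      unfolding G'_def H'_def using st assms l by (intro offline_state_snoc) auto
    have d: "d \<noteq> []" "d \<in> sequences (length d)" using st by (auto simp: offline_state_def)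
    \<comment> \<open>A lower bound for the next potential that involves only the online supply
      before \<open>v\<close> is revealed. Its average over a uniform \<open>v\<close> therefore
      needs only that the values \<open>m d v\<close> sum to \<open>1\<close>.\<close>
    define \<theta> where "\<theta> v = r * (if v = x then H + 1 else G - \<sigma> * \<epsilon>) - W d - (1 + \<epsilon>) * m d v" for v
    have \<theta>: "\<theta> v \<le> \<Phi> (d @ [axis v 1]) v (G' v) (H' v)" for v
    proof -
      have "W (d @ [axis v 1]) + \<epsilon> * m (d @ [axis v 1]) v \<le> W d + (1 + \<epsilon>) * m d v"
        unfolding W_def m_def
        using assms(1) l int[OF st] int[OF st', of v]
        by (intro online_welfare_snoc_le[OF assms(7) d]) auto
      moreover have "(1 - \<sigma>) * G' v + \<sigma> * H' v = (if v = x then H + 1 else G - \<sigma> * \<epsilon>)"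
        by (simp add: G'_def H'_def algebra_simps)
      ultimately show ?thesis by (simp add: \<theta>_def \<Phi>_def)
    qed
    obtain v where v: "(1 - p) * \<theta> x + p / real CARD('v) * (\<Sum>w\<in>UNIV. \<theta> w) \<le> \<theta> v"
      using obtain_ge_average[of p \<theta> x] p by auto
    have m1: "(\<Sum>w\<in>UNIV. m d w) = 1"
      unfolding m_def by (rule online_algorithm_nth(3)[OF assms(7) d])
    have "(\<Sum>w\<in>UNIV. (if w = x then H + 1 else G - \<sigma> * \<epsilon>)) = H + 1 + (real k - 1) * (G - \<sigma> * \<epsilon>)"
      using assms(3,4) by (subst sum.remove[of _ x]) (auto simp: card_Diff_singleton)
    then have sum: "(\<Sum>w\<in>UNIV. \<theta> w) =
        r * (H + 1 + (real k - 1) * (G - \<sigma> * \<epsilon>)) - real k * W d - (1 + \<epsilon>)"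
      using m1 assms(3) by (simp add: \<theta>_def sum_subtractf flip: sum_distrib_left)
    define Q where "Q = G - \<sigma> * \<epsilon>"
    have "(1 - p) * \<theta> x + p / real k * (\<Sum>w\<in>UNIV. \<theta> w) =
        r * ((1 - p + p / real k) * (H + 1) + (p - p / real k) * Q) - W d
        - (1 - p) * (1 + \<epsilon>) * m d x - p * (1 + \<epsilon>) / real k"
      using k unfolding sum unfolding \<theta>_def Q_def[symmetric] by (simp add: field_simps)
    also have "\<dots> = r * (\<sigma> * (H + 1) + (1 - \<sigma>) * Q) - W d - \<epsilon> * m d x - 1 / real k"
    proof -
      have "(1 - p) * (1 + \<epsilon>) = \<epsilon>" using p(3) by (simp add: algebra_simps)
      then show ?thesis by (simp add: p(3) \<sigma>_def)
    qed
    also have "\<dots> = \<Phi> d x G H + \<eta>"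
      by (simp add: \<Phi>_def \<eta>_def Q_def algebra_simps)
    finally have "\<Phi> d x G H + \<eta> \<le> \<theta> v" using v assms(3) by simp
    then show ?thesis using \<theta>[of v] st'[of v] by fastforce
  qed
  have "0 < \<eta>"
  proof -
    have p': "1 - p = \<epsilon> / (1 + \<epsilon>)" using assms(1) by (simp add: p_def field_simps)
    \<comment> \<open>Dropping the summand \<open>p / real k\<close> of \<open>\<sigma>\<close>
      leaves exactly the rate \<open>\<epsilon> / (1 + \<epsilon>)\<^sup>2\<close>, since
      \<open>1 - \<epsilon> + \<epsilon> * (1 - p) = p\<close>. The assumption
      \<open>\<epsilon> < 1\<close> makes the product monotone in \<open>\<sigma>\<close>.\<close>
    have "\<epsilon> / (1 + \<epsilon>)\<^sup>2 = (1 - p) * (1 - \<epsilon> + \<epsilon> * (1 - p))"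
      using assms(1) unfolding p' by (simp add: field_simps power2_eq_square)
    also have "\<dots> \<le> \<sigma> * (1 - \<epsilon> + \<epsilon> * \<sigma>)"
      using \<sigma> p assms(1,2) by (intro mult_mono add_left_mono mult_left_mono add_nonneg_nonneg) auto
    finally have "r * (\<epsilon> / (1 + \<epsilon>)\<^sup>2) \<le> r * (\<sigma> * (1 - \<epsilon> + \<epsilon> * \<sigma>))"
      using \<open>0 < r\<close> by (intro mult_left_mono) auto
    moreover have "1 / real k < r * (\<epsilon> / (1 + \<epsilon>)\<^sup>2)"
      using r(1) assms(1) k by (simp add: field_simps)
    ultimately show ?thesis by (simp add: \<eta>_def)
  qed
  fix x :: 'v
  define C where "C = \<Phi> [axis x 1] x 1 1"
  have grow: "\<exists>d x G H. offline_state l d x G H \<and> C + real n * \<eta> \<le> \<Phi> d x G H" for n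
  proof (induction n)
    case 0
    show ?case
      using offline_state_singleton[of l x] by (auto simp: C_def intro!: exI)
  next
    case (Suc n)
    then obtain d x G H where "offline_state l d x G H" "C + real n * \<eta> \<le> \<Phi> d x G H" by blast
    then obtain v G' H' where "offline_state l (d @ [axis v 1]) v G' H'"
        "\<Phi> d x G H + \<eta> \<le> \<Phi> (d @ [axis v 1]) v G' H'"
      using step by blast
    moreover from this have "C + real (Suc n) * \<eta> \<le> \<Phi> (d @ [axis v 1]) v G' H'"
      using \<open>C + real n * \<eta> \<le> \<Phi> d x G H\<close> by (simp add: algebra_simps)
    ultimately show ?case by blast
  qed
  \<comment> \<open>The assumed ratio forces \<open>W d \<ge> r * G\<close>, and \<open>G\<close>
    dominates the weighted certificate because \<open>H \<le> G\<close>. So the potential can never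
    become positive, while \<open>grow\<close> makes it exceed any bound.\<close>
  have bound: "\<Phi> d x G H \<le> 0" if st: "offline_state l d x G H" for d x G H
  proof -
    have "H \<le> G" using st by (simp add: offline_state_def)
    then have "(1 - \<sigma>) * G + \<sigma> * H \<le> (1 - \<sigma>) * G + \<sigma> * G"
      using \<sigma> p by (intro add_left_mono mult_left_mono) auto
    then have "(1 - \<sigma>) * G + \<sigma> * H \<le> G"
      by (simp add: algebra_simps)
    then have "r * ((1 - \<sigma>) * G + \<sigma> * H) \<le> r * G"
      using \<open>0 < r\<close> by (intro mult_left_mono) auto
    moreover have "0 \<le> \<epsilon> * m d x"
      using st assms(1) online_algorithm_nth(2)[OF assms(7), of d x]
      by (simp add: offline_state_def m_def)
    ultimately show ?thesis using W_ge[OF st] by (simp add: \<Phi>_def)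
  qed
  obtain n where "- C < real n * \<eta>"
    using reals_Archimedean3[OF \<open>0 < \<eta>\<close>] by blast
  with grow[of n] bound show False by fastforce
qed

end
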